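(* Let $k$ be an algebraically closed field and $q$ a prime number different from the characteristic of $k$. Let $f$ and $g$ be nonzero irreducible power series in $k[[x,y]]$. If the lowest degree form of $f$ has degree $\le 1$ and $f$ is a $q$th power modulo $g$, then $g$ is a $q$th power modulo $f$.
   Context: For $a,b\in k[[x,y]]$, "$a$ is a $q$th power modulo $b$" means there is $h\in k[[x,y]]$ with $a-h^q\in b\,k[[x,y]]$. The lowest degree form of a nonzero power series is its nonzero homogeneous component of smallest total degree in $x,y$. *)

theory Defs
  imports "HOL-Computational_Algebra.Computational_Algebra"
begin

text \<open>
  The ring $k[[x,y]]$ is represented as $k[[x]][[y]]$, i.e. by the type \<open>'k fps fps\<close>:
  the coefficient of $x^i y^j$ in \<open>f\<close> is \<open>f $ j $ i\<close>.
\<close>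

definition homogeneous :: "nat \<Rightarrow> 'k::zero fps fps \<Rightarrow> bool" where
  "homogeneous d f \<longleftrightarrow> (\<forall>i j. f $ j $ i \<noteq> 0 \<longrightarrow> i + j = d)"

definition homogeneous_component :: "nat \<Rightarrow> 'k::zero fps fps \<Rightarrow> 'k fps fps" where
  "homogeneous_component d f =
     Abs_fps (\<lambda>j. Abs_fps (\<lambda>i. if i + j = d then f $ j $ i else 0))"

text \<open>Only meaningful for \<open>f \<noteq> 0\<close>.\<close>

definition lowest_degree_form :: "'k::zero fps fps \<Rightarrow> 'k fps fps" where
  "lowest_degree_form f =
     homogeneous_component (LEAST d. homogeneous_component d f \<noteq> 0) f"

definition power_modulo :: "nat \<Rightarrow> 'k::comm_ring_1 fps fps \<Rightarrow> 'k fps fps \<Rightarrow> bool" where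
  "power_modulo q a b \<longleftrightarrow> (\<exists>h. b dvd a - h ^ q)"

lemma homogeneous_component_nth:
  "homogeneous_component d f $ j $ i = (if i + j = d then f $ j $ i else 0)"
  by (simp add: homogeneous_component_def)

lemma homogeneous_homogeneous_component: "homogeneous d (homogeneous_component d f)"
  by (auto simp: homogeneous_def homogeneous_component_nth)

lemma homogeneous_degree_unique:
  assumes "homogeneous d f" "homogeneous e f" "f \<noteq> 0"
  shows "d = e"
proof -
  from \<open>f \<noteq> 0\<close> obtain i j where "f $ j $ i \<noteq> 0"
    by (metis fps_nonzero_nth)
  with assms(1,2) show ?thesis
    by (metis homogeneous_def)
qed

lemma lowest_degree_form_nonzero:
  assumes "f \<noteq> 0"
  shows "lowest_degree_form f \<noteq> 0"
proof -
  from assms obtain i j where "f $ j $ i \<noteq> 0"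
    by (metis fps_nonzero_nth)
  then have "homogeneous_component (i + j) f $ j $ i \<noteq> 0"
    by (simp add: homogeneous_component_nth)
  then have "homogeneous_component (i + j) f \<noteq> 0"
    by auto
  then show ?thesis
    unfolding lowest_degree_form_def by (rule LeastI)
qed

end

theory Submission
  imports Defs
begin

text \<open>
  Being irreducible, \<open>f\<close> has no constant term, so it has order exactly \<open>1\<close> and defines a smooth
  branch. The quotient of $k[[x,y]]$ by \<open>f\<close> is then a power series ring $k[[t]]$;
  write $\pi$ for the quotient map. In $k[[t]]$ a
  nonzero series is a \<open>q\<close>th power as soon as \<open>q\<close> divides its order, because \<open>k\<close> is closed under
  \<open>q\<close>th roots and \<open>q\<close> is invertible in \<open>k\<close>. So everything comes down to showing that \<open>q\<close> divides
  the order \<open>n\<close> of \<open>\<pi> g\<close>, the intersection multiplicity of \<open>f\<close> and \<open>g\<close>, when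
  \<open>\<pi> g\<close> is nonzero; otherwise \<open>f\<close> divides \<open>g\<close>, and \<open>g\<close> is congruent to the \<open>q\<close>th power \<open>0\<close>.

  Conceptually, $f = h^q + g c$ shows that this multiplicity is the length of
  $k[[x,y]]/(g, h^q)$, which is \<open>q\<close> times the length of $k[[x,y]]/(g, h)$ because \<open>h\<close> is a
  nonzerodivisor modulo \<open>g\<close>. Here lengths can be avoided, since every ideal of $k[[t]]$ is generated
  by a power of \<open>t\<close>. Assume \<open>n > 0\<close>, and let \<open>m\<close> be the order of \<open>\<pi> h\<close>. As
  \<open>\<pi> g\<close> divides $(\pi h)^q$, we have
  \<open>n \<le> q m\<close>. Conversely, multiplication by \<open>\<pi> h\<close> on $k[[t]]/(t^n)$ annihilates exactly what
  $(\pi h)^{q-1}$ generates; this is the exactness coming from the nonzerodivisor property, and it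
  is the content of \<open>annihilator_in_ideal\<close>. Since $t^{n-m}$ is annihilated, \<open>n - m \<ge> (q - 1) m\<close>.
  Hence \<open>n = q m\<close>.

  The map \<open>\<pi>\<close> itself comes from division with remainder: if the inner variable occurs linearly in
  \<open>f\<close>, every series is congruent modulo \<open>f\<close> to exactly one series in the outer variable alone.
  If instead the outer variable occurs linearly, the variables are interchanged first.
\<close>

section \<open>Roots of power series in one variable\<close>

lemma fps_X_power_dvd_iff:
  fixes F :: "'k::field fps"
  shows "fps_X ^ n dvd F \<longleftrightarrow> (\<forall>i<n. F $ i = 0)"
proof (cases "F = 0")
  case False
  then show ?thesis
    by (auto simp: fps_dvd_iff intro: subdegree_geI nth_less_subdegree_zero)
qed auto

lemma power_add_second_order:
  fixes a b :: "'a::comm_ring_1"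
  obtains z where "(a + b) ^ q = a ^ q + of_nat q * a ^ (q - 1) * b + b\<^sup>2 * z"
proof -
  have "\<exists>z. (a + b) ^ q = a ^ q + of_nat q * a ^ (q - 1) * b + b\<^sup>2 * z"
  proof (induction q)
    case 0
    show ?case by (intro exI[of _ 0]) auto
  next
    case (Suc q)
    then obtain z where z: "(a + b) ^ q = a ^ q + of_nat q * a ^ (q - 1) * b + b\<^sup>2 * z"
      by blast
    have a: "of_nat q * a ^ (q - 1) * a = of_nat q * a ^ q"
      by (cases q) (auto simp: algebra_simps)
    have "(a + b) ^ Suc q = a ^ Suc q + of_nat q * a ^ (q - 1) * a * b + a ^ q * b
        + b\<^sup>2 * (of_nat q * a ^ (q - 1) + z * (a + b))"
      by (simp add: z algebra_simps power2_eq_square)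
    also have "\<dots> = a ^ Suc q + of_nat (Suc q) * a ^ (Suc q - 1) * b
        + b\<^sup>2 * (of_nat q * a ^ (q - 1) + z * (a + b))"
      unfolding a by (simp add: algebra_simps)
    finally show ?case by blast
  qed
  then show thesis using that by blast
qed

text \<open>
  Newton iteration: if \<open>w\<close> is a root modulo $t^{n+1}$, adding \<open>b\<close> with $t^{n+1} \mid b$ changes the
  \<open>q\<close>th power by $q w^{q-1} b$ modulo $t^{n+2}$, and $q w^{q-1}$ is a unit. The iterates converge
  coefficientwise, the \<open>n\<close>th coefficient being stable from step \<open>n\<close> on.
\<close>

lemma fps_unit_root_exists:
  fixes u :: "'k::field fps"
  assumes "of_nat q \<noteq> (0::'k)" and "c \<noteq> 0" and "c ^ q = u $ 0"
  obtains v where "v ^ q = u"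
proof -
  define P where "P n w \<longleftrightarrow> fps_X ^ Suc n dvd u - w ^ q \<and> w $ 0 \<noteq> 0" for n and w :: "'k fps"
  define R where "R n w w' \<longleftrightarrow> fps_X ^ Suc n dvd w' - w" for n and w w' :: "'k fps"
  have "\<exists>w. \<forall>n. P n (w n) \<and> R n (w n) (w (Suc n))"
  proof (rule dependent_nat_choice)
    have "P 0 (fps_const c)"
      unfolding P_def fps_X_power_dvd_iff using assms by simp
    then show "\<exists>w. P 0 w" ..
  next
    fix w n assume "P n w"
    then obtain e where e: "u - w ^ q = fps_X ^ Suc n * e" and w: "w $ 0 \<noteq> 0"
      unfolding P_def by (auto elim: dvdE)
    define d where "d = of_nat q * w ^ (q - 1)"
    have d0: "d $ 0 \<noteq> 0"
      using w assms(1) by (simp add: d_def flip: fps_of_nat)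
    define b where "b = fps_X ^ Suc n * (e * inverse d)"
    obtain z where z: "(w + b) ^ q = w ^ q + of_nat q * w ^ (q - 1) * b + b\<^sup>2 * z"
      by (rule power_add_second_order)
    have "d * b = fps_X ^ Suc n * e * (inverse d * d)"
      by (simp add: b_def algebra_simps)
    then have "d * b = u - w ^ q"
      using d0 e by (simp add: inverse_mult_eq_1)
    then have "u - (w + b) ^ q = b\<^sup>2 * (- z)"
      using z by (simp add: d_def)
    moreover have "fps_X ^ Suc (Suc n) dvd b\<^sup>2"
    proof -
      have "b\<^sup>2 = fps_X ^ Suc (Suc n) * (fps_X ^ n * (e * inverse d)\<^sup>2)"
        by (simp add: b_def power2_eq_square algebra_simps)
      then show ?thesis by simp
    qed
    ultimately have "P (Suc n) (w + b)"
      unfolding P_def using w by (simp add: b_def)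
    moreover have "R n w (w + b)"
      by (simp add: R_def b_def)
    ultimately show "\<exists>w'. P (Suc n) w' \<and> R n w w'" by blast
  qed
  then obtain w where w: "\<And>n. P n (w n)" "\<And>n. R n (w n) (w (Suc n))"
    by blast
  have stable: "w (n + k) $ n = w n $ n" for n k
  proof (induction k)
    case (Suc k)
    have "(w (Suc (n + k)) - w (n + k)) $ n = 0"
      using w(2)[of "n + k"] unfolding R_def fps_X_power_dvd_iff by auto
    then show ?case using Suc by simp
  qed simp
  define v where "v = Abs_fps (\<lambda>n. w n $ n)"
  have "(u - v ^ q) $ n = 0" for n
  proof -
    have "fps_X ^ Suc n dvd v - w n"
      unfolding fps_X_power_dvd_iff
    proof (intro allI impI)
      fix i assume "i < Suc n"
      then show "(v - w n) $ i = 0"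
        using stable[of i "n - i"] by (simp add: v_def)
    qed
    moreover have "v - w n dvd v ^ q - w n ^ q"
      by (simp add: power_diff_sumr2)
    ultimately have "fps_X ^ Suc n dvd v ^ q - w n ^ q"
      by (rule dvd_trans)
    moreover have "fps_X ^ Suc n dvd u - w n ^ q"
      using w(1)[of n] by (simp add: P_def)
    ultimately have "fps_X ^ Suc n dvd (u - w n ^ q) - (v ^ q - w n ^ q)"
      by (rule dvd_diff[rotated])
    then have "fps_X ^ Suc n dvd u - v ^ q" by simp
    then show ?thesis unfolding fps_X_power_dvd_iff by blast
  qed
  then have "v ^ q = u" by (auto simp: fps_eq_iff)
  then show thesis by (rule that)
qed

lemma fps_root_exists:
  fixes s :: "'k::alg_closed_field fps"
  assumes "of_nat q \<noteq> (0::'k)" and "q dvd subdegree s"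
  obtains r where "r ^ q = s"
proof (cases "s = 0")
  case True
  have "q \<noteq> 0" using assms(1) by (intro notI) simp
  with True show ?thesis using that[of 0] by (simp add: power_0_left)
next
  case False
  have "q > 0" using assms(1) by (intro gr0I notI) simp
  obtain c where c: "c ^ q = unit_factor s $ 0"
    using nth_root_exists[OF \<open>q > 0\<close>] by blast
  have "c \<noteq> 0"
  proof
    assume "c = 0"
    then have "unit_factor s $ 0 = 0"
      using c \<open>q > 0\<close> by (simp add: power_0_left)
    then show False using False by simp
  qed
  then obtain v where v: "v ^ q = unit_factor s"
    using fps_unit_root_exists[OF assms(1) _ c] by blast
  obtain m where m: "subdegree s = q * m" using assms(2) by (rule dvdE)
  have "(v * fps_X ^ m) ^ q = unit_factor s * fps_X ^ subdegree s"
    by (simp add: v m power_mult_distrib mult.commute[of q m] power_mult)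
  also have "\<dots> = s" by (metis fps_unit_factor_decompose)
  finally show ?thesis by (rule that)
qed

section \<open>Smooth branches\<close>

text \<open>
  The branch \<open>f\<close> is smooth when its coordinate ring is a power series ring in one variable, and \<open>\<pi>\<close>
  is then the quotient map. No parameter of the branch is singled out, so that branches transversal
  to either coordinate axis are covered alike.
\<close>

locale smooth_branch =
  fixes f :: "'k::field fps fps" and \<pi> :: "'k fps fps \<Rightarrow> 'k fps"
  assumes nonzero: "f \<noteq> 0"
    and map_one: "\<pi> 1 = 1"
    and map_add: "\<pi> (F + G) = \<pi> F + \<pi> G"
    and map_mult: "\<pi> (F * G) = \<pi> F * \<pi> G"
    and surjective: "\<exists>F. \<pi> F = r"
    and kernel: "\<pi> F = 0 \<longleftrightarrow> f dvd F"
begin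

lemma map_power: "\<pi> (F ^ n) = \<pi> F ^ n"
  by (induction n) (simp_all add: map_one map_mult)

lemma map_diff: "\<pi> (F - G) = \<pi> F - \<pi> G"
  using map_add[of "F - G" G] by simp

lemma map_self: "\<pi> f = 0"
  by (simp add: kernel)

text \<open>
  Modulo \<open>g\<close> the factor \<open>h\<close> divides $h^q$, which agrees with \<open>f\<close>; and \<open>f\<close> is a nonzerodivisor
  modulo \<open>g\<close> because \<open>f\<close> is prime and does not divide \<open>g\<close>.
\<close>

lemma nonzerodivisor_modulo:
  assumes f: "f - h ^ q = g * c" and "q > 0" and g: "\<pi> g \<noteq> 0"
    and w: "h * w = g * z"
  shows "g dvd w"
proof -
  have "h ^ q = h ^ (q - 1) * h"
    using \<open>q > 0\<close> by (cases q) auto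
  then have "f = h ^ (q - 1) * h + g * c"
    using f by (simp add: algebra_simps)
  then have "f * w = h ^ (q - 1) * (h * w) + g * c * w"
    by (simp add: algebra_simps)
  then have fw: "f * w = g * (h ^ (q - 1) * z + c * w)"
    by (simp add: w algebra_simps)
  then have "\<pi> g * \<pi> (h ^ (q - 1) * z + c * w) = 0"
    by (metis map_mult map_self mult_zero_left)
  then have "f dvd h ^ (q - 1) * z + c * w"
    using g kernel by auto
  then obtain y where "h ^ (q - 1) * z + c * w = f * y" ..
  then have "f * w = f * (g * y)"
    using fw by (simp add: algebra_simps)
  then show ?thesis using nonzero by simp
qed

text \<open>
  Lift the relation to $k[[x,y]]$, where it holds modulo \<open>f\<close>, that is, modulo $h^q$ and \<open>g\<close>;
  then cancel one factor \<open>h\<close>.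
\<close>

lemma annihilator_in_ideal:
  assumes f: "f - h ^ q = g * c" and "q > 0" and g: "\<pi> g \<noteq> 0"
    and p: "\<pi> h * p = \<pi> g * s"
  obtains a b where "p = \<pi> h ^ (q - 1) * a + \<pi> g * b"
proof -
  obtain u where u: "\<pi> u = p" using surjective by blast
  obtain v where v: "\<pi> v = s" using surjective by blast
  have "\<pi> (h * u - g * v) = 0"
    using p by (simp add: map_diff map_mult u v)
  then obtain y where y: "h * u - g * v = f * y"
    using kernel by (auto elim: dvdE)
  have "f = h * h ^ (q - 1) + g * c"
    using f \<open>q > 0\<close> by (cases q) (auto simp: algebra_simps)
  then have "f * y = h * (h ^ (q - 1) * y) + g * (c * y)"
    by (simp add: algebra_simps)
  then have "h * (u - h ^ (q - 1) * y) = g * (v + c * y)"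
    using y by (simp add: algebra_simps)
  then have "g dvd u - h ^ (q - 1) * y"
    by (rule nonzerodivisor_modulo[OF f \<open>q > 0\<close> g])
  then obtain b where "u - h ^ (q - 1) * y = g * b" ..
  then have "u = h ^ (q - 1) * y + g * b"
    by (simp add: algebra_simps)
  then have "p = \<pi> h ^ (q - 1) * \<pi> y + \<pi> g * \<pi> b"
    unfolding u[symmetric] by (simp add: map_add map_mult map_power)
  then show thesis by (rule that)
qed

text \<open>
  With \<open>n\<close> and \<open>m\<close> the orders of \<open>\<pi> g\<close> and \<open>\<pi> h\<close>, the relation $f = h^q + g c$ gives
  \<open>n \<le> q m\<close> directly, and \<open>annihilator_in_ideal\<close>, applied to the power $t^{n-m}$ that
  \<open>\<pi> h\<close> multiplies into the ideal of \<open>\<pi> g\<close>, gives the reverse inequality if \<open>n > 0\<close>.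
\<close>

lemma dvd_intersection_multiplicity:
  assumes f: "f - h ^ q = g * c" and q: "q \<ge> 2" and g: "\<pi> g \<noteq> 0"
  shows "q dvd subdegree (\<pi> g)"
proof (cases "subdegree (\<pi> g) = 0")
  case False
  define n where "n = subdegree (\<pi> g)"
  have "n > 0" using False by (simp add: n_def)
  have "q > 0" using q by simp
  note ideal = annihilator_in_ideal[OF f \<open>q > 0\<close> g]
  have "\<pi> f - \<pi> h ^ q = \<pi> g * \<pi> c"
    using f by (metis map_diff map_mult map_power)
  then have dvd: "\<pi> g dvd \<pi> h ^ q"
    by (metis diff_0 dvd_minus_iff dvd_triv_left map_self)
  have h: "\<pi> h \<noteq> 0"
  proof
    assume "\<pi> h = 0"
    then obtain a b where "1 = \<pi> h ^ (q - 1) * a + \<pi> g * b"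
      using ideal[of 1 0] by auto
    then have "1 = \<pi> g * b"
      using \<open>\<pi> h = 0\<close> q by (simp add: power_0_left)
    then have "\<pi> g dvd 1" ..
    then show False using False by auto
  qed
  define m where "m = subdegree (\<pi> h)"
  have "n \<le> q * m"
    using dvd g h by (simp add: fps_dvd_iff n_def m_def)
  then have "m > 0"
    using \<open>n > 0\<close> by (cases m) auto
  \<comment> \<open>For \<open>m \<ge> n\<close> the exponent \<open>n - m\<close> is truncated to \<open>0\<close>, and \<open>1\<close> is indeed annihilated.\<close>
  have "\<pi> g dvd \<pi> h * fps_X ^ (n - m)"
    using g h by (simp add: fps_dvd_iff n_def m_def)
  then obtain s where "\<pi> h * fps_X ^ (n - m) = \<pi> g * s" ..
  then obtain a b where ab: "fps_X ^ (n - m) = \<pi> h ^ (q - 1) * a + \<pi> g * b"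
    by (rule ideal)
  define l where "l = min ((q - 1) * m) n"
  have X: "fps_X ^ l dvd \<pi> h ^ (q - 1)" "fps_X ^ l dvd \<pi> g"
    using g h by (simp_all add: fps_dvd_iff l_def m_def n_def)
  have "fps_X ^ l dvd (fps_X ^ (n - m) :: 'k fps)"
    unfolding ab using X by simp
  then have "l \<le> n - m"
    by (simp add: fps_dvd_iff)
  then have "(q - 1) * m \<le> n - m"
    using \<open>m > 0\<close> \<open>n > 0\<close> by (auto simp: l_def)
  moreover have "(q - 1) * m \<ge> 1"
    using q \<open>m > 0\<close> by (cases "q - 1") auto
  moreover have "(q - 1) * m + m = q * m"
    using q by (cases q) auto
  ultimately have "q * m \<le> n"
    by linarith
  with \<open>n \<le> q * m\<close> have "n = q * m" by simp
  then show ?thesis by (simp add: n_def)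
qed simp

lemma power_modulo_branch:
  assumes "q \<ge> 2" and "power_modulo q f g"
    and root: "\<And>s :: 'k fps. q dvd subdegree s \<Longrightarrow> \<exists>r. r ^ q = s"
  shows "power_modulo q g f"
proof -
  obtain h c where c: "f - h ^ q = g * c"
    using assms(2) by (auto simp: power_modulo_def elim: dvdE)
  have "q dvd subdegree (\<pi> g)"
    using dvd_intersection_multiplicity[OF c \<open>q \<ge> 2\<close>] by (cases "\<pi> g = 0") auto
  then obtain r where "r ^ q = \<pi> g"
    using root by blast
  moreover obtain R where "\<pi> R = r"
    using surjective by blast
  ultimately have "\<pi> (g - R ^ q) = 0"
    by (simp add: map_diff map_power)
  then show ?thesis
    by (auto simp: power_modulo_def kernel)
qed

end

section \<open>Series of order one define smooth branches\<close>

text \<open>The inclusion of the series in the outer variable alone.\<close>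

definition outer :: "'k::zero fps \<Rightarrow> 'k fps fps" where
  "outer r = Abs_fps (\<lambda>n. fps_const (r $ n))"

lemma outer_one: "outer 1 = 1"
  by (auto simp: outer_def fps_eq_iff)

lemma outer_add: "outer (r + s) = outer r + outer (s :: 'k::comm_ring_1 fps)"
  by (auto simp: outer_def fps_eq_iff)

lemma outer_diff: "outer (r - s) = outer r - outer (s :: 'k::comm_ring_1 fps)"
  by (auto simp: outer_def fps_eq_iff)

lemma outer_mult: "outer (r * s) = outer r * outer (s :: 'k::comm_ring_1 fps)"
  by (auto simp: outer_def fps_eq_iff fps_mult_nth fps_sum_nth)

text \<open>
  The coefficients of the quotient of \<open>F\<close> by \<open>f\<close>, when the lowest coefficient of \<open>f\<close> is the
  inner variable times a unit: what remains of the \<open>n\<close>th coefficient of \<open>F\<close> is split into a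
  constant, left to the remainder, and a multiple of the inner variable. Summing over a list lets
  the congruence rule for \<open>map\<close> establish termination.
\<close>

fun division_quotient :: "'k::field fps fps \<Rightarrow> 'k fps fps \<Rightarrow> nat \<Rightarrow> 'k fps" where
  "division_quotient f F n =
     fps_shift 1 (F $ n - (\<Sum>i\<leftarrow>[0..<n]. division_quotient f F i * f $ (n - i)))
       * inverse (fps_shift 1 (f $ 0))"

declare division_quotient.simps [simp del]

lemma division_exists:
  fixes f F :: "'k::field fps fps"
  assumes f0: "f $ 0 $ 0 = 0" and f1: "f $ 0 $ 1 \<noteq> 0"
  shows "\<exists>r. f dvd F - outer r"
proof -
  define Q where "Q = Abs_fps (division_quotient f F)"
  define E where "E n = F $ n - (\<Sum>i<n. Q $ i * f $ (n - i))" for n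
  define v where "v = fps_shift 1 (f $ 0)"
  have v: "f $ 0 = fps_X * v" "v $ 0 \<noteq> 0"
    using f0 f1 by (auto simp: v_def fps_eq_iff)
  have Q: "Q $ n = fps_shift 1 (E n) * inverse v" for n
    by (simp add: Q_def E_def v_def division_quotient.simps[of f F n]
        interv_sum_list_conv_sum_set_nat atLeast0LessThan)
  have "F - outer (Abs_fps (\<lambda>n. E n $ 0)) = f * Q"
  proof (rule fps_ext)
    fix n
    have "(f * Q) $ n = (\<Sum>i\<le>n. Q $ i * f $ (n - i))"
      by (simp add: mult.commute[of f] fps_mult_nth atLeast0AtMost)
    also have "\<dots> = (\<Sum>i<n. Q $ i * f $ (n - i)) + Q $ n * f $ 0"
      by (simp add: lessThan_Suc_atMost[symmetric])
    also have "Q $ n * f $ 0 = fps_X * fps_shift 1 (E n) * (inverse v * v)"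
      unfolding Q v(1) by (simp add: algebra_simps)
    also have "\<dots> = E n - fps_const (E n $ 0)"
      using v(2) by (simp add: inverse_mult_eq_1) (auto simp: fps_eq_iff)
    finally show "(F - outer (Abs_fps (\<lambda>n. E n $ 0))) $ n = (f * Q) $ n"
      by (simp add: E_def outer_def)
  qed
  then have "f dvd F - outer (Abs_fps (\<lambda>n. E n $ 0))"
    by simp
  then show ?thesis ..
qed

text \<open>
  Uniqueness of the remainder. If the first \<open>n\<close> coefficients of the cofactor \<open>Q\<close> vanish, the \<open>n\<close>th
  coefficient of \<open>Q * f\<close> is a multiple of \<open>f $ 0\<close>, a nonzero series without constant term; it can
  be a constant only if it is \<open>0\<close>.
\<close>

lemma dvd_outer_imp_zero:
  fixes f :: "'k::field fps fps"
  assumes f0: "f $ 0 $ 0 = 0" and f1: "f $ 0 \<noteq> 0" and dvd: "f dvd outer r"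
  shows "r = 0"
proof -
  obtain Q where Q: "outer r = Q * f"
    using dvd by (metis dvd_def mult.commute)
  have "Q $ n = 0" for n
  proof (induction n rule: less_induct)
    case (less n)
    have "fps_const (r $ n) = (Q * f) $ n"
      by (simp add: outer_def flip: Q)
    also have "\<dots> = (\<Sum>i<n. Q $ i * f $ (n - i)) + Q $ n * f $ 0"
      by (simp add: fps_mult_nth atLeast0AtMost lessThan_Suc_atMost[symmetric])
    also have "(\<Sum>i<n. Q $ i * f $ (n - i)) = 0"
      using less by simp
    finally have eq: "fps_const (r $ n) = Q $ n * f $ 0" by simp
    then have "fps_const (r $ n) $ 0 = (Q $ n * f $ 0) $ 0" by (rule arg_cong)
    then have "r $ n = 0" using f0 by simp
    then show ?case using eq f1 by simp
  qed
  then have "Q = 0" by (auto simp: fps_eq_iff)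
  then have "outer r = 0" using Q by simp
  then have "outer r $ n $ 0 = 0" for n by simp
  then show ?thesis by (simp add: outer_def fps_eq_iff)
qed

text \<open>
  Taking remainders is a ring homomorphism because remainders are unique and the series in the outer
  variable alone form a subring.
\<close>

lemma smooth_branch_transversal:
  fixes f :: "'k::field fps fps"
  assumes f0: "f $ 0 $ 0 = 0" and f1: "f $ 0 $ 1 \<noteq> 0"
  shows "\<exists>\<pi>. smooth_branch f \<pi>"
proof -
  have "\<forall>F. \<exists>r. f dvd F - outer r"
    using division_exists[OF assms] by blast
  then obtain \<pi> where \<pi>: "\<And>F. f dvd F - outer (\<pi> F)"
    by metis
  have f0': "f $ 0 \<noteq> 0" using f1 by auto
  have unique: "\<pi> F = r" if "f dvd F - outer r" for F r
  proof -
    have "f dvd (F - outer r) - (F - outer (\<pi> F))"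
      using that \<pi> by (rule dvd_diff)
    then have "f dvd outer (\<pi> F - r)"
      by (simp add: outer_diff)
    then show ?thesis
      using dvd_outer_imp_zero[OF f0 f0'] by fastforce
  qed
  have "smooth_branch f \<pi>"
  proof
    show "f \<noteq> 0" using f0' by auto
    show "\<pi> 1 = 1" by (rule unique) (simp add: outer_one)
    show "\<pi> (F + G) = \<pi> F + \<pi> G" for F G
    proof (rule unique)
      have "f dvd (F - outer (\<pi> F)) + (G - outer (\<pi> G))"
        using \<pi> by (intro dvd_add)
      then show "f dvd F + G - outer (\<pi> F + \<pi> G)"
        by (simp add: outer_add algebra_simps)
    qed
    show "\<pi> (F * G) = \<pi> F * \<pi> G" for F G
    proof (rule unique)
      have "f dvd (F - outer (\<pi> F)) * G + outer (\<pi> F) * (G - outer (\<pi> G))"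
        using \<pi> by (intro dvd_add dvd_mult dvd_mult2)
      then show "f dvd F * G - outer (\<pi> F * \<pi> G)"
        by (simp add: outer_mult algebra_simps)
    qed
    have "\<pi> (outer r) = r" for r by (rule unique) simp
    then show "\<exists>F. \<pi> F = r" for r by blast
    have outer_zero: "outer 0 = (0 :: 'k fps fps)"
      by (auto simp: outer_def fps_eq_iff)
    show "\<pi> F = 0 \<longleftrightarrow> f dvd F" for F
      using unique[of F 0] \<pi>[of F] by (auto simp: outer_zero)
  qed
  then show ?thesis by blast
qed

definition swap_vars :: "'k::zero fps fps \<Rightarrow> 'k fps fps" where
  "swap_vars F = Abs_fps (\<lambda>i. Abs_fps (\<lambda>j. F $ j $ i))"

lemma swap_vars_nth [simp]: "swap_vars F $ i $ j = F $ j $ i"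
  by (simp add: swap_vars_def)

lemma swap_vars_swap_vars [simp]: "swap_vars (swap_vars F) = F"
  by (auto simp: fps_eq_iff)

lemma swap_vars_one: "swap_vars 1 = 1"
  by (auto simp: fps_eq_iff)

lemma swap_vars_add: "swap_vars (F + G) = swap_vars F + swap_vars (G :: 'k::comm_ring_1 fps fps)"
  by (auto simp: fps_eq_iff)

lemma swap_vars_mult: "swap_vars (F * G) = swap_vars F * swap_vars (G :: 'k::comm_ring_1 fps fps)"
proof (intro fps_ext)
  fix i j
  show "swap_vars (F * G) $ i $ j = (swap_vars F * swap_vars G) $ i $ j"
    by (simp add: fps_mult_nth fps_sum_nth sum.swap[of _ "{0..j}"])
qed

lemma swap_vars_dvd_iff:
  "swap_vars f dvd swap_vars F \<longleftrightarrow> f dvd (F :: 'k::comm_ring_1 fps fps)"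
  by (metis dvd_def swap_vars_mult swap_vars_swap_vars)

lemma smooth_branch_swap:
  assumes "smooth_branch (swap_vars f) \<pi>"
  shows "smooth_branch f (\<pi> \<circ> swap_vars)"
proof -
  interpret smooth_branch "swap_vars f" \<pi> by fact
  show ?thesis
  proof
    show "f \<noteq> 0" using nonzero by (auto simp: fps_eq_iff)
    show "\<exists>F. (\<pi> \<circ> swap_vars) F = r" for r
      using surjective by (metis comp_apply swap_vars_swap_vars)
  qed (simp_all add: swap_vars_one swap_vars_add swap_vars_mult map_one map_add map_mult
        kernel swap_vars_dvd_iff)
qed

lemma smooth_branch_order_one:
  fixes f :: "'k::field fps fps"
  assumes "f $ 0 $ 0 = 0" and "f $ 0 $ 1 \<noteq> 0 \<or> f $ 1 $ 0 \<noteq> 0"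
  shows "\<exists>\<pi>. smooth_branch f \<pi>"
  using assms smooth_branch_transversal[of f] smooth_branch_transversal[of "swap_vars f"]
    smooth_branch_swap by fastforce

lemma irreducible_const_coeff:
  fixes f :: "'k::field fps fps"
  assumes "irreducible f"
  shows "f $ 0 $ 0 = 0"
proof (rule ccontr)
  assume "f $ 0 $ 0 \<noteq> 0"
  then have "f $ 0 * inverse (f $ 0) = 1"
    by (rule inverse_mult_eq_1')
  then have "f * fps_right_inverse f (inverse (f $ 0)) = 1"
    by (rule fps_right_inverse)
  then have "f dvd 1" by (metis dvd_triv_left)
  with assms show False by (simp add: irreducible_def)
qed

theorem corollary3p5:
  fixes f g :: "'k::alg_closed_field fps fps" and q d :: nat
  assumes "prime q" and "q \<noteq> CHAR('k)"
    and "f \<noteq> 0" and "irreducible f"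
    and "g \<noteq> 0" and "irreducible g"
    and "homogeneous d (lowest_degree_form f)" and "d \<le> 1"
    and "power_modulo q f g"
  shows "power_modulo q g f"
proof -
  have f0: "f $ 0 $ 0 = 0"
    using \<open>irreducible f\<close> by (rule irreducible_const_coeff)
  obtain i j where ij: "lowest_degree_form f $ j $ i \<noteq> 0"
    using lowest_degree_form_nonzero[OF \<open>f \<noteq> 0\<close>] by (metis fps_nonzero_nth)
  then have "i + j = d"
    using \<open>homogeneous d (lowest_degree_form f)\<close> unfolding homogeneous_def by blast
  moreover have "f $ j $ i \<noteq> 0"
    using ij by (auto simp: lowest_degree_form_def homogeneous_component_nth split: if_splits)
  ultimately have "f $ 0 $ 1 \<noteq> 0 \<or> f $ 1 $ 0 \<noteq> 0"
    using f0 \<open>d \<le> 1\<close> by (cases i; cases j) auto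
  then obtain \<pi> where "smooth_branch f \<pi>"
    using smooth_branch_order_one[OF f0] by blast
  moreover have "of_nat q \<noteq> (0::'k)"
    using \<open>prime q\<close> \<open>q \<noteq> CHAR('k)\<close> CHAR_not_1 [where ?'a = 'k]
    by (auto simp: of_nat_eq_0_iff_char_dvd prime_nat_iff)
  then have "\<exists>r. r ^ q = s" if "q dvd subdegree s" for s :: "'k fps"
    using that by (meson fps_root_exists)
  ultimately show ?thesis
    using smooth_branch.power_modulo_branch prime_ge_2_nat[OF \<open>prime q\<close>]
      \<open>power_modulo q f g\<close> by blast
qed

end
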